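(* Consider the interconnected system $$x_{t+1}=x_t+\delta\,S(x_t,z_t),\qquad z_{t+1}=F(x_t,z_t),\qquad t\in\mathbb{N},$$ with $S:\mathbb{R}^n\times\mathbb{R}^m\to\mathbb{R}^n$, $F:\mathbb{R}^n\times\mathbb{R}^m\to\mathbb{R}^m$ and parameter $\delta>0$. Suppose the following hold. (1) There are nonempty closed sets $X\subseteq\mathbb{R}^n$, $Z\subseteq\mathbb{R}^m$ such that $x+\delta' S(x,z)\in X$ and $F(x,z)\in Z$ for all $x\in X$, $z\in Z$, $\delta'\in[0,1]$. (2) There is a set-valued map $Z_{\mathrm{FIX}}:X\rightrightarrows Z$ with $Z_{\mathrm{FIX}}(x)$ nonempty and closed for all $x\in X$, such that $\bar z=F(x,\bar z)$ for all $x\in X$ and $\bar z\in Z_{\mathrm{FIX}}(x)$; moreover there is $L_{\mathrm{FIX}}>0$ with $d_F(z,Z_{\mathrm{FIX}}(x'))\le L_{\mathrm{FIX}}\,d_S(x,x')$ for all $x,x'\in X$ and $z\in Z_{\mathrm{FIX}}(x)$. (3) There is $c_F\in(0,1)$ with $d_F(F(x,z),Z_{\mathrm{FIX}}(x))\le c_F\,d_F(z,Z_{\mathrm{FIX}}(x))$ for all $(x,z)\in X\times Z$. (4) There is $R:X\to\mathbb{R}^n$ with $R(x)=S(x,z)$ for all $x\in X$ and $z\in Z_{\mathrm{FIX}}(x)$. (5) There are $L_S,L_R>0$ with $\|S(x,z)-S(x,z')\|_S\le L_S\|z-z'\|_F$ and $\|R(x)-R(x')\|_S\le L_R\|x-x'\|_S$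 for all $(x,z),(x',z')\in X\times Z$. (6) There is $c_S\in(0,1)$ with $d_S(x+R(x),x'+R(x'))\le(1-c_S)\,d_S(x,x')$ for all $x,x'\in X$. Let $x_\star\in X$ be the unique fixed point of $x\mapsto x+R(x)$ in $X$, and define $$\bar\delta:=\frac{c_S(1-c_F)}{L_{\mathrm{FIX}}L_S(c_S+L_R)}.$$ Then, for every $\delta\in(0,\min\{\bar\delta,1\})$, there exist $C>0$ and $\rho\in(0,1)$ such that the trajectories of the system satisfy $$\left\|\begin{bmatrix}d_S(x_t,x_\star)\\ d_F(z_t,Z_{\mathrm{FIX}}(x_t))\end{bmatrix}\right\|\le C\rho^t\left\|\begin{bmatrix}d_S(x_0,x_\star)\\ d_F(z_0,Z_{\mathrm{FIX}}(x_0))\end{bmatrix}\right\|$$ for all initial conditions $(x_0,z_0)\in X\times Z$ and all $t\in\mathbb{N}$. In particular, $x_t\to x_\star$ and $d_F(z_t,Z_{\mathrm{FIX}}(x_t))\to0$ linearly.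
   Context: $\|\cdot\|_F$ and $\|\cdot\|_S$ are norms induced by inner products on $\mathbb{R}^m$ and $\mathbb{R}^n$ respectively, with distances $d_F(z,z')=\|z-z'\|_F$ and $d_S(x,x')=\|x-x'\|_S$. For sets, $d_F(z,Z')=\inf_{y\in Z'}d_F(z,y)$ and $d_S(x,X')=\inf_{y\in X'}d_S(x,y)$. $\|\cdot\|$ (no subscript) is the Euclidean norm. The constants $C,\rho$ do not depend on the initial condition or on $t$. *)

theory Defs
  imports "HOL-Analysis.Analysis"
begin

definition inner_product :: "('a::real_vector \<Rightarrow> 'a \<Rightarrow> real) \<Rightarrow> bool" where
  "inner_product ip \<longleftrightarrow>
     bilinear ip \<and> (\<forall>u v. ip u v = ip v u) \<and> (\<forall>u. u \<noteq> 0 \<longrightarrow> 0 < ip u u)"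

definition ip_norm :: "('a::real_vector \<Rightarrow> 'a \<Rightarrow> real) \<Rightarrow> 'a \<Rightarrow> real" where
  "ip_norm ip u = sqrt (ip u u)"

definition ip_dist :: "('a::real_vector \<Rightarrow> 'a \<Rightarrow> real) \<Rightarrow> 'a \<Rightarrow> 'a \<Rightarrow> real" where
  "ip_dist ip u v = ip_norm ip (u - v)"

(* Meaningful only for nonempty A: the infimum of the empty set is unspecified in type real. *)
definition ip_setdist :: "('a::real_vector \<Rightarrow> 'a \<Rightarrow> real) \<Rightarrow> 'a \<Rightarrow> 'a set \<Rightarrow> real" where
  "ip_setdist ip u A = (INF v\<in>A. ip_dist ip u v)"

definition trajectory ::
  "('a::real_vector \<Rightarrow> 'b \<Rightarrow> 'a) \<Rightarrow> ('a \<Rightarrow> 'b \<Rightarrow> 'b) \<Rightarrow> real \<Rightarrow> (nat \<Rightarrow> 'a) \<Rightarrow> (nat \<Rightarrow> 'b) \<Rightarrow> bool" where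
  "trajectory S F \<delta> x z \<longleftrightarrow>
     (\<forall>t. x (Suc t) = x t + \<delta> *\<^sub>R S (x t) (z t) \<and> z (Suc t) = F (x t) (z t))"

(* Linear convergence in the sense of a geometric bound on the error (R-linear convergence). *)
definition vanishes_linearly :: "(nat \<Rightarrow> real) \<Rightarrow> bool" where
  "vanishes_linearly e \<longleftrightarrow>
     e \<longlonglongrightarrow> 0 \<and> (\<exists>K \<rho>. 0 < K \<and> 0 < \<rho> \<and> \<rho> < 1 \<and> (\<forall>t. \<bar>e t\<bar> \<le> K * \<rho> ^ t))"

end

theory Submission
  imports Defs
begin

text \<open>
  Write \<open>a\<^sub>t\<close> for the slow error \<open>d\<^sub>S(x\<^sub>t, x\<^sub>*)\<close> and \<open>b\<^sub>t\<close> for the fast error \<open>d\<^sub>F(z\<^sub>t, Zfix(x\<^sub>t))\<close>.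
  They satisfy two coupled linear inequalities, and the bound on \<open>\<delta>\<close> is exactly what makes the
  corresponding nonnegative matrix a contraction in a suitable weighted norm.

  Slow error. A damped step \<open>x + \<delta> R(x)\<close> is a convex combination of \<open>x\<close> and \<open>x + R(x)\<close>, so it
  moves towards \<open>x\<^sub>*\<close> with factor \<open>1 - \<delta> c\<^sub>S\<close>. The true step uses \<open>S(x, z)\<close> in place of \<open>R(x) = S(x, v)\<close>
  with \<open>v \<in> Zfix(x)\<close>; the Lipschitz bound on \<open>S\<close>, taken over all such \<open>v\<close>, limits the discrepancy
  to \<open>L\<^sub>S b\<^sub>t\<close>. Hence \<open>a\<^sub>t\<^sub>+\<^sub>1 \<le> (1 - \<delta> c\<^sub>S) a\<^sub>t + \<delta> L\<^sub>S b\<^sub>t\<close>.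

  Fast error. The map \<open>F(x\<^sub>t, -)\<close> shrinks the distance to \<open>Zfix(x\<^sub>t)\<close> by the factor \<open>c\<^sub>F\<close>, but then the
  target set moves to \<open>Zfix(x\<^sub>t\<^sub>+\<^sub>1)\<close>, which costs at most \<open>L\<^sub>F\<^sub>I\<^sub>X\<close> times the step length
  (lemma \<open>ip_setdist_change_set\<close>). Since \<open>R(x\<^sub>*) = 0\<close>, the step length is at most
  \<open>\<delta> (L\<^sub>R a\<^sub>t + L\<^sub>S b\<^sub>t)\<close>. Hence \<open>b\<^sub>t\<^sub>+\<^sub>1 \<le> \<delta> L\<^sub>F\<^sub>I\<^sub>X L\<^sub>R a\<^sub>t + (c\<^sub>F + \<delta> L\<^sub>F\<^sub>I\<^sub>X L\<^sub>S) b\<^sub>t\<close>.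

  The sum \<open>p a + b\<close> with a weight \<open>p > 0\<close> is multiplied by a factor below one, coefficient by
  coefficient, iff \<open>L\<^sub>F\<^sub>I\<^sub>X L\<^sub>R / c\<^sub>S < p < (1 - c\<^sub>F - \<delta> L\<^sub>F\<^sub>I\<^sub>X L\<^sub>S) / (\<delta> L\<^sub>S)\<close>. This interval is nonempty
  precisely when \<open>\<delta>\<close> is below the stated threshold (lemma \<open>small_gain_weight\<close>). The weighted sum then
  decays geometrically (lemma \<open>weighted_sum_geometric_decay\<close>) and is comparable with the Euclidean
  norm of the pair (lemma \<open>norm_vector_2_decay\<close>).

  The point \<open>x\<^sub>*\<close> is a Banach fixed point, found through the Euclidean metric because the norm of the
  contraction hypothesis is equivalent to the Euclidean one (lemma \<open>ip_contraction_fixed_point\<close>).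
\<close>

section \<open>Norms induced by inner products\<close>

lemma ip_norm_square:
  assumes "inner_product ip"
  shows "(ip_norm ip u)\<^sup>2 = ip u u"
proof -
  have "ip 0 0 = 0"
    using assms bilinear_lzero by (auto simp: inner_product_def)
  then have "0 \<le> ip u u"
    using assms by (cases "u = 0") (auto simp: inner_product_def less_imp_le)
  then show ?thesis
    by (simp add: ip_norm_def)
qed

lemma ip_norm_nonneg:
  assumes "inner_product ip"
  shows "0 \<le> ip_norm ip u"
proof -
  have "0 \<le> ip u u"
    using ip_norm_square[OF assms, of u] by (metis zero_le_power2)
  then show ?thesis
    by (simp add: ip_norm_def)
qed

lemma ip_norm_zero:
  assumes "inner_product ip"
  shows "ip_norm ip 0 = 0"
  using assms bilinear_lzero by (auto simp: inner_product_def ip_norm_def)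

lemma ip_norm_pos:
  assumes "inner_product ip" "u \<noteq> 0"
  shows "0 < ip_norm ip u"
  using assms by (simp add: inner_product_def ip_norm_def)

lemma ip_norm_scaleR:
  assumes "inner_product ip"
  shows "ip_norm ip (c *\<^sub>R u) = \<bar>c\<bar> * ip_norm ip u"
proof -
  have "ip (c *\<^sub>R u) (c *\<^sub>R u) = c\<^sup>2 * ip u u"
    using assms
    by (simp add: inner_product_def bilinear_lmul bilinear_rmul power2_eq_square)
  then show ?thesis
    by (simp add: ip_norm_def real_sqrt_mult)
qed

lemma ip_norm_minus_commute:
  assumes "inner_product ip"
  shows "ip_norm ip (u - v) = ip_norm ip (v - u)"
  using ip_norm_scaleR[OF assms, of "-1" "u - v"] by simp

lemma ip_Cauchy_Schwarz:
  assumes "inner_product ip"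
  shows "ip u v \<le> ip_norm ip u * ip_norm ip v"
proof (cases "u = 0 \<or> v = 0")
  case True
  have "ip 0 v = 0" "ip u 0 = 0"
    using assms bilinear_lzero bilinear_rzero by (auto simp: inner_product_def)
  with True show ?thesis
    using ip_norm_zero[OF assms] by auto
next
  case False
  define a b where "a = ip_norm ip u" and "b = ip_norm ip v"
  have pos: "0 < a" "0 < b"
    using False ip_norm_pos[OF assms] by (auto simp: a_def b_def)
  have bil: "bilinear ip" and sym: "ip v u = ip u v"
    using assms by (auto simp: inner_product_def)
  \<comment> \<open>The vectors \<open>b u\<close> and \<open>a v\<close> have the same length, so the square of the length of their
    difference has \<open>a b\<close> as a factor.\<close>
  have "0 \<le> (ip_norm ip (b *\<^sub>R u - a *\<^sub>R v))\<^sup>2"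
    by simp
  also have "\<dots> = b\<^sup>2 * ip u u + a\<^sup>2 * ip v v - 2 * a * b * ip u v"
    unfolding ip_norm_square[OF assms]
    by (simp add: bilinear_lsub[OF bil] bilinear_rsub[OF bil] bilinear_lmul[OF bil]
        bilinear_rmul[OF bil] sym power2_eq_square algebra_simps)
  also have "ip u u = a\<^sup>2"
    by (simp add: a_def ip_norm_square[OF assms])
  also have "ip v v = b\<^sup>2"
    by (simp add: b_def ip_norm_square[OF assms])
  also have "b\<^sup>2 * a\<^sup>2 + a\<^sup>2 * b\<^sup>2 - 2 * a * b * ip u v = (2 * a * b) * (a * b - ip u v)"
    by (simp add: power2_eq_square algebra_simps)
  finally have "0 \<le> (2 * a * b) * (a * b - ip u v)" .
  moreover have "0 < 2 * a * b"
    using pos by simp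
  ultimately have "0 \<le> a * b - ip u v"
    by (meson leD mult_pos_neg not_le)
  then show ?thesis
    by (simp add: a_def b_def)
qed

lemma ip_norm_triangle:
  assumes "inner_product ip"
  shows "ip_norm ip (u + v) \<le> ip_norm ip u + ip_norm ip v"
proof (rule power2_le_imp_le)
  have bil: "bilinear ip" and sym: "ip v u = ip u v"
    using assms by (auto simp: inner_product_def)
  have "(ip_norm ip (u + v))\<^sup>2 = ip u u + ip v v + 2 * ip u v"
    unfolding ip_norm_square[OF assms]
    by (simp add: bilinear_ladd[OF bil] bilinear_radd[OF bil] sym)
  also have "\<dots> \<le> (ip_norm ip u)\<^sup>2 + (ip_norm ip v)\<^sup>2 + 2 * (ip_norm ip u * ip_norm ip v)"
    using ip_Cauchy_Schwarz[OF assms, of u v] by (simp add: ip_norm_square[OF assms])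
  also have "\<dots> = (ip_norm ip u + ip_norm ip v)\<^sup>2"
    by (simp add: power2_eq_square algebra_simps)
  finally show "(ip_norm ip (u + v))\<^sup>2 \<le> (ip_norm ip u + ip_norm ip v)\<^sup>2" .
qed (simp add: ip_norm_nonneg[OF assms])

lemma ip_dist_triangle:
  assumes "inner_product ip"
  shows "ip_dist ip u w \<le> ip_dist ip u v + ip_dist ip v w"
  using ip_norm_triangle[OF assms, of "u - v" "v - w"] by (simp add: ip_dist_def)

text \<open>
  In finite dimension the induced norm is continuous and positive on the compact unit sphere, so it
  is bounded there from both sides by positive constants; homogeneity does the rest.
\<close>

lemma ip_norm_equivalent:
  fixes ip :: "'a::euclidean_space \<Rightarrow> 'a \<Rightarrow> real"
  assumes "inner_product ip"
  obtains k K where "0 < k" "0 < K"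
    "\<And>u. k * norm u \<le> ip_norm ip u" "\<And>u. ip_norm ip u \<le> K * norm u"
proof -
  have "bounded_bilinear ip"
    using assms by (simp add: inner_product_def bilinear_conv_bounded_bilinear)
  then have cont: "continuous_on (sphere 0 1) (ip_norm ip)"
    unfolding ip_norm_def
    by (intro continuous_on_real_sqrt bounded_bilinear.continuous_on[of ip] continuous_on_id)
  have ne: "sphere (0::'a) 1 \<noteq> {}"
    by simp
  obtain l where l: "l \<in> sphere 0 1" "\<And>u. u \<in> sphere 0 1 \<Longrightarrow> ip_norm ip l \<le> ip_norm ip u"
    using continuous_attains_inf[OF compact_sphere ne cont] by blast
  obtain h where h: "h \<in> sphere 0 1" "\<And>u. u \<in> sphere 0 1 \<Longrightarrow> ip_norm ip u \<le> ip_norm ip h"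
    using continuous_attains_sup[OF compact_sphere ne cont] by blast
  have scaled: "\<exists>e\<in>sphere 0 1. ip_norm ip u = norm u * ip_norm ip e" if "u \<noteq> 0" for u
  proof (rule bexI[of _ "inverse (norm u) *\<^sub>R u"])
    show "ip_norm ip u = norm u * ip_norm ip (inverse (norm u) *\<^sub>R u)"
      using that by (simp add: ip_norm_scaleR[OF assms])
  qed (use that in simp)
  show thesis
  proof (rule that[of "ip_norm ip l" "ip_norm ip h"])
    show "0 < ip_norm ip l" "0 < ip_norm ip h"
      using l(1) h(1) by (auto intro!: ip_norm_pos[OF assms])
    show "ip_norm ip l * norm u \<le> ip_norm ip u" for u
      using scaled[of u] l(2) by (cases "u = 0")
        (auto simp: ip_norm_zero[OF assms] mult.commute mult_right_mono)
    show "ip_norm ip u \<le> ip_norm ip h * norm u" for u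
      using scaled[of u] h(2) by (cases "u = 0")
        (auto simp: ip_norm_zero[OF assms] mult.commute mult_right_mono)
  qed
qed

section \<open>Distance to a set\<close>

lemma ip_setdist_le:
  assumes "inner_product ip" "v \<in> A"
  shows "ip_setdist ip u A \<le> ip_dist ip u v"
  unfolding ip_setdist_def
proof (rule cINF_lower)
  show "bdd_below (ip_dist ip u ` A)"
    using ip_norm_nonneg[OF assms(1)] by (auto intro!: bdd_belowI[of _ 0] simp: ip_dist_def)
qed fact

lemma ip_setdist_greatest:
  assumes "A \<noteq> {}" "\<And>v. v \<in> A \<Longrightarrow> c \<le> ip_dist ip u v"
  shows "c \<le> ip_setdist ip u A"
  unfolding ip_setdist_def using assms by (rule cINF_greatest)

lemma ip_setdist_nonneg:
  assumes "inner_product ip" "A \<noteq> {}"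
  shows "0 \<le> ip_setdist ip u A"
  using assms(2) by (rule ip_setdist_greatest) (simp add: ip_dist_def ip_norm_nonneg[OF assms(1)])

lemma ip_setdist_triangle:
  assumes "inner_product ip" "A \<noteq> {}"
  shows "ip_setdist ip u A \<le> ip_dist ip u v + ip_setdist ip v A"
proof -
  have "ip_setdist ip u A - ip_dist ip u v \<le> ip_setdist ip v A"
  proof (rule ip_setdist_greatest[OF assms(2)])
    fix w assume "w \<in> A"
    then have "ip_setdist ip u A \<le> ip_dist ip u w"
      by (rule ip_setdist_le[OF assms(1)])
    also have "\<dots> \<le> ip_dist ip u v + ip_dist ip v w"
      by (rule ip_dist_triangle[OF assms(1)])
    finally show "ip_setdist ip u A - ip_dist ip u v \<le> ip_dist ip v w"
      by simp
  qed
  then show ?thesis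
    by simp
qed

text \<open>
  Replacing the target set \<open>B\<close> by \<open>A\<close> costs at most the one-sided Hausdorff excess of \<open>B\<close> over \<open>A\<close>,
  because one can go to a nearly closest point of \<open>B\<close> first. This accounts for the drift of the
  set of fast equilibria while the slow state moves.
\<close>

lemma ip_setdist_change_set:
  assumes "inner_product ip" "A \<noteq> {}" "B \<noteq> {}" "\<And>v. v \<in> B \<Longrightarrow> ip_setdist ip v A \<le> c"
  shows "ip_setdist ip u A \<le> ip_setdist ip u B + c"
proof -
  have "ip_setdist ip u A - c \<le> ip_setdist ip u B"
  proof (rule ip_setdist_greatest[OF assms(3)])
    fix v assume "v \<in> B"
    then show "ip_setdist ip u A - c \<le> ip_dist ip u v"
      using assms(4)[of v] ip_setdist_triangle[OF assms(1,2), of u v] by linarith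
  qed
  then show ?thesis
    by simp
qed

section \<open>Fixed points of contractions in an induced norm\<close>

text \<open>
  Norm equivalence costs a constant factor, so the map itself may fail to contract Euclidean
  distances. A high iterate absorbs that factor, and its unique fixed point is sent by the map to
  another fixed point of the iterate, hence to itself.
\<close>

lemma ip_contraction_fixed_point:
  fixes T :: "'a::euclidean_space \<Rightarrow> 'a"
  assumes ip: "inner_product ip" and A: "closed A" "A \<noteq> {}"
    and into: "\<And>x. x \<in> A \<Longrightarrow> T x \<in> A"
    and q: "0 \<le> q" "q < 1"
    and contr: "\<And>x y. x \<in> A \<Longrightarrow> y \<in> A \<Longrightarrow> ip_dist ip (T x) (T y) \<le> q * ip_dist ip x y"
  shows "\<exists>!p. p \<in> A \<and> T p = p"
proof -
  obtain k K where k: "0 < k" "0 < K"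
    and lower: "\<And>u. k * norm u \<le> ip_norm ip u" and upper: "\<And>u. ip_norm ip u \<le> K * norm u"
    using ip_norm_equivalent[OF ip] by metis
  have iter_into: "(T ^^ n) x \<in> A" if "x \<in> A" for n x
    using that by (induction n) (auto intro: into)
  have iter_contr: "ip_dist ip ((T ^^ n) x) ((T ^^ n) y) \<le> q ^ n * ip_dist ip x y"
    if "x \<in> A" "y \<in> A" for n x y
  proof (induction n)
    case (Suc n)
    have "ip_dist ip ((T ^^ Suc n) x) ((T ^^ Suc n) y) \<le> q * ip_dist ip ((T ^^ n) x) ((T ^^ n) y)"
      using contr iter_into that by simp
    also have "\<dots> \<le> q * (q ^ n * ip_dist ip x y)"
      using Suc q(1) by (rule mult_left_mono)
    finally show ?case
      by (simp add: mult.assoc)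
  qed simp
  obtain N where N: "q ^ N < k / (2 * K)"
    using real_arch_pow_inv[of "k / (2 * K)" q] k q by auto
  have "\<exists>!p\<in>A. (T ^^ N) p = p"
  proof (rule Banach_fix[where c = "1/2"])
    show "dist ((T ^^ N) x) ((T ^^ N) y) \<le> 1/2 * dist x y" if "x \<in> A" "y \<in> A" for x y
    proof -
      have "k * dist ((T ^^ N) x) ((T ^^ N) y) \<le> ip_dist ip ((T ^^ N) x) ((T ^^ N) y)"
        using lower by (simp add: dist_norm ip_dist_def)
      also have "\<dots> \<le> q ^ N * ip_dist ip x y"
        by (rule iter_contr[OF that])
      also have "\<dots> \<le> (k / (2 * K)) * (K * dist x y)"
        using N upper[of "x - y"] k ip_norm_nonneg[OF ip]
        by (intro mult_mono) (auto simp: dist_norm ip_dist_def)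
      also have "\<dots> = k * (1/2 * dist x y)"
        using k by simp
      finally show ?thesis
        using k by simp
    qed
  qed (use A iter_into in \<open>auto simp: complete_eq_closed\<close>)
  then obtain p where p: "p \<in> A" "(T ^^ N) p = p"
    and unique: "\<And>y. y \<in> A \<Longrightarrow> (T ^^ N) y = y \<Longrightarrow> y = p"
    by blast
  have "(T ^^ N) (T p) = T p"
    using p(2) by (metis funpow_swap1)
  then have "T p = p"
    using unique into p(1) by blast
  moreover have "y = p" if "y \<in> A" "T y = y" for y
  proof -
    have "(T ^^ n) y = y" for n
      using that(2) by (induction n) auto
    then show ?thesis
      using unique that(1) by blast
  qed
  ultimately show ?thesis
    using p(1) by blast
qed

section \<open>Coupled linear inequalities\<close>

text \<open>
  The weight \<open>p\<close> must exceed \<open>l * r / c\<close> for the first coordinate to decrease and stay below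
  \<open>(1 - f - \<delta> * l * s) / (\<delta> * s)\<close> for the second; the bound on \<open>\<delta>\<close> says that there is room between.
\<close>

lemma small_gain_weight:
  fixes c f l s r \<delta> :: real
  assumes pos: "0 < c" "0 < f" "0 < l" "0 < s" "0 < r" "0 < \<delta>"
    and small: "\<delta> < c * (1 - f) / (l * s * (c + r))"
  obtains p \<rho> where "0 < p" "0 < \<rho>" "\<rho> < 1"
    "p * (1 - \<delta> * c) + \<delta> * l * r \<le> \<rho> * p"
    "p * (\<delta> * s) + (f + \<delta> * l * s) \<le> \<rho>"
proof -
  have "\<delta> * (l * s * (c + r)) < c * (1 - f)"
    using small pos by (simp add: pos_less_divide_eq)
  then have "l * r * (\<delta> * s) < (1 - f - \<delta> * l * s) * c"
    by (simp add: algebra_simps)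
  then have "l * r / c < (1 - f - \<delta> * l * s) / (\<delta> * s)"
    using pos by (simp add: divide_less_eq less_divide_eq)
  then obtain p where p: "l * r / c < p" "p < (1 - f - \<delta> * l * s) / (\<delta> * s)"
    using dense by blast
  have p_pos: "0 < p"
    using p(1) pos by (meson divide_pos_pos less_trans mult_pos_pos)
  define u v where "u = (p * (1 - \<delta> * c) + \<delta> * l * r) / p"
    and "v = p * (\<delta> * s) + (f + \<delta> * l * s)"
  have "\<delta> * (l * r) < \<delta> * (p * c)"
    using p(1) pos by (simp add: pos_divide_less_eq)
  then have "u < 1"
    unfolding u_def using p_pos by (simp add: pos_divide_less_eq algebra_simps)
  moreover have "v < 1"
    unfolding v_def using p(2) pos by (simp add: pos_less_divide_eq)
  moreover have "0 < v"
    unfolding v_def using p_pos pos by (simp add: add_pos_pos)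
  moreover have "p * (1 - \<delta> * c) + \<delta> * l * r = u * p"
    unfolding u_def using p_pos by simp
  then have "p * (1 - \<delta> * c) + \<delta> * l * r \<le> max u v * p"
    using p_pos by simp
  ultimately show thesis
    using p_pos by (intro that[of p "max u v"]) (auto simp: v_def)
qed

lemma weighted_sum_geometric_decay:
  fixes a b :: "nat \<Rightarrow> real"
  assumes nonneg: "\<And>t. 0 \<le> a t" "\<And>t. 0 \<le> b t" and "0 \<le> p" "0 \<le> \<rho>"
    and step: "\<And>t. a (Suc t) \<le> m11 * a t + m12 * b t" "\<And>t. b (Suc t) \<le> m21 * a t + m22 * b t"
    and weight: "p * m11 + m21 \<le> \<rho> * p" "p * m12 + m22 \<le> \<rho>"
  shows "p * a t + b t \<le> \<rho> ^ t * (p * a 0 + b 0)"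
proof (induction t)
  case (Suc t)
  have "p * a (Suc t) + b (Suc t) \<le> p * (m11 * a t + m12 * b t) + (m21 * a t + m22 * b t)"
    using step \<open>0 \<le> p\<close> by (intro add_mono mult_left_mono)
  also have "\<dots> = (p * m11 + m21) * a t + (p * m12 + m22) * b t"
    by (simp add: algebra_simps)
  also have "\<dots> \<le> (\<rho> * p) * a t + \<rho> * b t"
    using weight nonneg by (intro add_mono mult_right_mono)
  also have "\<dots> = \<rho> * (p * a t + b t)"
    by (simp add: algebra_simps)
  also have "\<dots> \<le> \<rho> * (\<rho> ^ t * (p * a 0 + b 0))"
    using Suc \<open>0 \<le> \<rho>\<close> by (rule mult_left_mono)
  finally show ?case
    by (simp add: mult.assoc)
qed simp

lemma norm_vector_2: "norm (vector [a, b] :: real ^ 2) = sqrt (a\<^sup>2 + b\<^sup>2)"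
  by (simp add: norm_vec_def L2_set_def sum_2)

text \<open>
  Conversion of decay of a weighted sum into decay of the Euclidean norm; the constant
  compares \<open>min p 1 * (a + b) \<le> p * a + b\<close> on the left with \<open>p * a' + b' \<le> (p + 1) * n\<close> on the
  right, where \<open>n\<close> is the Euclidean norm of \<open>(a', b')\<close>.
\<close>

lemma norm_vector_2_decay:
  fixes a b a' b' p r :: real
  assumes "0 \<le> a" "0 \<le> b" "0 < p" "0 \<le> r"
    and le: "p * a + b \<le> r * (p * a' + b')"
  shows "norm (vector [a, b] :: real ^ 2)
    \<le> (p + 1) / min p 1 * r * norm (vector [a', b'] :: real ^ 2)"
proof -
  define n where "n = norm (vector [a', b'] :: real ^ 2)"
  have n: "a' \<le> n" "b' \<le> n"
    by (auto simp: n_def norm_vector_2 intro: real_sqrt_sum_squares_ge1 real_sqrt_sum_squares_ge2)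
  have "min p 1 * norm (vector [a, b] :: real ^ 2) \<le> min p 1 * (a + b)"
    using assms sqrt_sum_squares_le_sum[of a b] by (intro mult_left_mono) (auto simp: norm_vector_2)
  also have "\<dots> \<le> p * a + 1 * b"
    unfolding distrib_left using assms by (intro add_mono mult_right_mono) auto
  also have "\<dots> \<le> r * (p * a' + b')"
    using le by simp
  also have "\<dots> \<le> r * (p * n + n)"
    using n assms by (intro mult_left_mono add_mono) auto
  also have "\<dots> = (p + 1) * r * n"
    by (simp add: algebra_simps)
  finally show ?thesis
    using assms by (simp add: n_def field_simps)
qed

lemma vanishes_linearly_if_geometric_bound:
  assumes \<rho>: "0 < \<rho>" "\<rho> < 1" and bound: "\<And>t. \<bar>e t\<bar> \<le> K * \<rho> ^ t"
  shows "vanishes_linearly e"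
proof -
  \<comment> \<open>A trajectory at rest satisfies the bound with \<open>K = 0\<close>, while the definition asks for a
    positive constant.\<close>
  have "\<bar>e t\<bar> \<le> (\<bar>K\<bar> + 1) * \<rho> ^ t" for t
    using bound[of t] \<rho> by (meson abs_ge_self add_increasing2 mult_right_mono order_trans
        zero_le_one zero_le_power less_imp_le)
  moreover have "e \<longlonglongrightarrow> 0"
  proof (rule Lim_null_comparison)
    show "\<forall>\<^sub>F t in sequentially. norm (e t) \<le> K * \<rho> ^ t"
      using bound by simp
    show "(\<lambda>t. K * \<rho> ^ t) \<longlonglongrightarrow> 0"
      using \<rho> by (intro tendsto_mult_right_zero LIMSEQ_realpow_zero) auto
  qed
  ultimately show ?thesis
    unfolding vanishes_linearly_def using \<rho> by (intro conjI exI[of _ "\<bar>K\<bar> + 1"] exI[of _ \<rho>]) auto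
qed

section \<open>Linear convergence of the interconnection\<close>

theorem theorem1:
  fixes S :: "real ^ 'n \<Rightarrow> real ^ 'm \<Rightarrow> real ^ 'n"
    and F :: "real ^ 'n \<Rightarrow> real ^ 'm \<Rightarrow> real ^ 'm"
    and ipS :: "real ^ 'n \<Rightarrow> real ^ 'n \<Rightarrow> real"
    and ipF :: "real ^ 'm \<Rightarrow> real ^ 'm \<Rightarrow> real"
    and X :: "(real ^ 'n) set"
    and Z :: "(real ^ 'm) set"
    and Zfix :: "real ^ 'n \<Rightarrow> (real ^ 'm) set"
    and R :: "real ^ 'n \<Rightarrow> real ^ 'n"
    and L_FIX c_F L_S L_R c_S :: real
  assumes ipS: "inner_product ipS"
    and ipF: "inner_product ipF"
    and X: "X \<noteq> {}" "closed X"
    and Z: "Z \<noteq> {}" "closed Z"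
    and invariant: "\<forall>x\<in>X. \<forall>z\<in>Z. \<forall>\<delta>'\<in>{0..1}. x + \<delta>' *\<^sub>R S x z \<in> X \<and> F x z \<in> Z"
    and Zfix: "\<forall>x\<in>X. Zfix x \<noteq> {} \<and> closed (Zfix x) \<and> Zfix x \<subseteq> Z"
    and Zfix_fixed: "\<forall>x\<in>X. \<forall>zbar\<in>Zfix x. zbar = F x zbar"
    and L_FIX: "0 < L_FIX"
      "\<forall>x\<in>X. \<forall>x'\<in>X. \<forall>z\<in>Zfix x. ip_setdist ipF z (Zfix x') \<le> L_FIX * ip_dist ipS x x'"
    and c_F: "0 < c_F" "c_F < 1"
      "\<forall>x\<in>X. \<forall>z\<in>Z. ip_setdist ipF (F x z) (Zfix x) \<le> c_F * ip_setdist ipF z (Zfix x)"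
    and R: "\<forall>x\<in>X. \<forall>z\<in>Zfix x. R x = S x z"
    and L_S: "0 < L_S"
      "\<forall>x\<in>X. \<forall>z\<in>Z. \<forall>z'\<in>Z. ip_norm ipS (S x z - S x z') \<le> L_S * ip_norm ipF (z - z')"
    and L_R: "0 < L_R"
      "\<forall>x\<in>X. \<forall>x'\<in>X. ip_norm ipS (R x - R x') \<le> L_R * ip_norm ipS (x - x')"
    and c_S: "0 < c_S" "c_S < 1"
      "\<forall>x\<in>X. \<forall>x'\<in>X. ip_dist ipS (x + R x) (x' + R x') \<le> (1 - c_S) * ip_dist ipS x x'"
  shows "\<exists>xstar\<in>X.
    xstar + R xstar = xstar \<and> (\<forall>y\<in>X. y + R y = y \<longrightarrow> y = xstar) \<and>
    (\<forall>\<delta>. 0 < \<delta> \<and> \<delta> < min (c_S * (1 - c_F) / (L_FIX * L_S * (c_S + L_R))) 1 \<longrightarrow>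
      (\<exists>C \<rho>. 0 < C \<and> 0 < \<rho> \<and> \<rho> < 1 \<and>
        (\<forall>x z. trajectory S F \<delta> x z \<and> x 0 \<in> X \<and> z 0 \<in> Z \<longrightarrow>
          (\<forall>t. norm (vector [ip_dist ipS (x t) xstar, ip_setdist ipF (z t) (Zfix (x t))] :: real ^ 2)
             \<le> C * \<rho> ^ t *
               norm (vector [ip_dist ipS (x 0) xstar, ip_setdist ipF (z 0) (Zfix (x 0))] :: real ^ 2)))) \<and>
      (\<forall>x z. trajectory S F \<delta> x z \<and> x 0 \<in> X \<and> z 0 \<in> Z \<longrightarrow>
        x \<longlonglongrightarrow> xstar \<and>
        vanishes_linearly (\<lambda>t. ip_dist ipS (x t) xstar) \<and>
        vanishes_linearly (\<lambda>t. ip_setdist ipF (z t) (Zfix (x t)))))"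
proof -
  let ?dS = "ip_dist ipS" and ?nS = "ip_norm ipS" and ?dF = "ip_setdist ipF"
  have step_in: "x + d *\<^sub>R S x z \<in> X" "F x z \<in> Z" if "x \<in> X" "z \<in> Z" "0 \<le> d" "d \<le> 1" for x z d
    using bspec[OF bspec[OF bspec[OF invariant that(1)] that(2)], of d] that by auto
  have Zfix_ne: "Zfix x \<noteq> {}" and Zfix_sub: "Zfix x \<subseteq> Z" if "x \<in> X" for x
    using bspec[OF Zfix that] by auto
  have R_eq: "R x = S x z" if "x \<in> X" "z \<in> Zfix x" for x z
    using bspec[OF bspec[OF R that(1)] that(2)] .
  have map_in: "x + R x \<in> X" if x: "x \<in> X" for x
  proof -
    obtain z where z: "z \<in> Zfix x"
      using Zfix_ne[OF x] by blast
    then have "z \<in> Z" "R x = S x z"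
      using Zfix_sub[OF x] R_eq[OF x] by auto
    then show ?thesis
      using step_in(1)[OF x, of z 1] by simp
  qed
  have "\<exists>!p. p \<in> X \<and> p + R p = p"
    using ip_contraction_fixed_point[OF ipS X(2,1), of "\<lambda>x. x + R x" "1 - c_S"] map_in c_S by simp
  then obtain xstar where xstar: "xstar \<in> X" "xstar + R xstar = xstar"
    and unique: "\<And>y. y \<in> X \<Longrightarrow> y + R y = y \<Longrightarrow> y = xstar"
    by blast

  have mismatch: "?nS (S x z - R x) \<le> L_S * ?dF z (Zfix x)" if "x \<in> X" "z \<in> Z" for x z
  proof -
    have "?nS (S x z - R x) / L_S \<le> ?dF z (Zfix x)"
    proof (rule ip_setdist_greatest)
      fix v assume v: "v \<in> Zfix x"
      have "R x = S x v" "v \<in> Z"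
        using R_eq[OF that(1) v] Zfix_sub[OF that(1)] v by auto
      then have "?nS (S x z - R x) \<le> L_S * ip_norm ipF (z - v)"
        using bspec[OF bspec[OF bspec[OF L_S(2) that(1)] that(2)], of v] by simp
      then show "?nS (S x z - R x) / L_S \<le> ip_dist ipF z v"
        using L_S(1) by (simp add: ip_dist_def pos_divide_le_eq mult.commute)
    qed (rule Zfix_ne[OF that(1)])
    then show ?thesis
      using L_S(1) by (simp add: pos_divide_le_eq mult.commute)
  qed

  have slow: "?dS (x + d *\<^sub>R S x z) xstar
      \<le> (1 - d * c_S) * ?dS x xstar + d * L_S * ?dF z (Zfix x)"
    if xz: "x \<in> X" "z \<in> Z" and d: "0 < d" "d < 1" for x z d
  proof -
    \<comment> \<open>Convex combination of the identity and the contraction \<open>x + R x\<close>, plus the error made by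
      driving the slow state with \<open>z\<close> instead of a fast equilibrium.\<close>
    have "x + d *\<^sub>R S x z - xstar
        = ((1 - d) *\<^sub>R (x - xstar) + d *\<^sub>R (x + R x - xstar)) + d *\<^sub>R (S x z - R x)"
      by (simp add: algebra_simps)
    then have "?dS (x + d *\<^sub>R S x z) xstar
        \<le> ?nS ((1 - d) *\<^sub>R (x - xstar)) + ?nS (d *\<^sub>R (x + R x - xstar)) + ?nS (d *\<^sub>R (S x z - R x))"
      unfolding ip_dist_def by (smt (verit) ip_norm_triangle[OF ipS])
    also have "\<dots> = (1 - d) * ?dS x xstar + d * ?dS (x + R x) xstar + d * ?nS (S x z - R x)"
      using d by (simp add: ip_norm_scaleR[OF ipS] ip_dist_def)
    also have "\<dots> \<le> (1 - d) * ?dS x xstar + d * ((1 - c_S) * ?dS x xstar)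
        + d * (L_S * ?dF z (Zfix x))"
    proof (intro add_mono mult_left_mono order_refl)
      show "?dS (x + R x) xstar \<le> (1 - c_S) * ?dS x xstar"
        using bspec[OF bspec[OF c_S(3) xz(1)] xstar(1)] xstar(2) by simp
      show "?nS (S x z - R x) \<le> L_S * ?dF z (Zfix x)"
        using mismatch xz by blast
    qed (use d in auto)
    finally show ?thesis
      by (simp add: algebra_simps)
  qed

  have fast: "?dF (F x z) (Zfix (x + d *\<^sub>R S x z))
      \<le> d * L_FIX * L_R * ?dS x xstar + (c_F + d * L_FIX * L_S) * ?dF z (Zfix x)"
    if xz: "x \<in> X" "z \<in> Z" and d: "0 < d" "d < 1" for x z d
  proof -
    let ?x' = "x + d *\<^sub>R S x z"
    have x': "?x' \<in> X"
      using step_in(1)[OF xz, of d] d by simp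
    \<comment> \<open>The slow velocity vanishes at the fixed point.\<close>
    have "R xstar = 0"
      using xstar(2) by simp
    then have "?nS (R x) \<le> L_R * ?dS x xstar"
      using bspec[OF bspec[OF L_R(2) xz(1)] xstar(1)] by (simp add: ip_dist_def)
    then have "?nS (S x z) \<le> L_S * ?dF z (Zfix x) + L_R * ?dS x xstar"
      using ip_norm_triangle[OF ipS, of "S x z - R x" "R x"] mismatch[OF xz] by simp
    then have velocity: "d * L_FIX * ?nS (S x z)
        \<le> d * L_FIX * (L_S * ?dF z (Zfix x) + L_R * ?dS x xstar)"
      using d L_FIX(1) by (intro mult_left_mono) auto
    have step_length: "?dS x ?x' = d * ?nS (S x z)"
      using d ip_norm_minus_commute[OF ipS, of x ?x'] by (simp add: ip_dist_def ip_norm_scaleR[OF ipS])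
    have "?dF (F x z) (Zfix ?x') \<le> ?dF (F x z) (Zfix x) + L_FIX * ?dS x ?x'"
    proof (rule ip_setdist_change_set[OF ipF])
      show "Zfix ?x' \<noteq> {}" "Zfix x \<noteq> {}"
        by (rule Zfix_ne[OF x'], rule Zfix_ne[OF xz(1)])
      show "?dF v (Zfix ?x') \<le> L_FIX * ?dS x ?x'" if "v \<in> Zfix x" for v
        using bspec[OF bspec[OF bspec[OF L_FIX(2) xz(1)] x'] that] .
    qed
    also have "\<dots> \<le> c_F * ?dF z (Zfix x) + L_FIX * ?dS x ?x'"
      using bspec[OF bspec[OF c_F(3) xz(1)] xz(2)] by simp
    finally show ?thesis
      using velocity by (simp add: step_length algebra_simps)
  qed

  obtain k where k: "0 < k" "\<And>u. k * norm u \<le> ?nS u"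
    using ip_norm_equivalent[OF ipS] by metis

  have main: "(\<exists>C \<rho>. 0 < C \<and> 0 < \<rho> \<and> \<rho> < 1 \<and>
        (\<forall>x z. trajectory S F \<delta> x z \<and> x 0 \<in> X \<and> z 0 \<in> Z \<longrightarrow>
          (\<forall>t. norm (vector [?dS (x t) xstar, ?dF (z t) (Zfix (x t))] :: real ^ 2)
             \<le> C * \<rho> ^ t *
               norm (vector [?dS (x 0) xstar, ?dF (z 0) (Zfix (x 0))] :: real ^ 2)))) \<and>
      (\<forall>x z. trajectory S F \<delta> x z \<and> x 0 \<in> X \<and> z 0 \<in> Z \<longrightarrow>
        x \<longlonglongrightarrow> xstar \<and>
        vanishes_linearly (\<lambda>t. ?dS (x t) xstar) \<and>
        vanishes_linearly (\<lambda>t. ?dF (z t) (Zfix (x t))))"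
    if "0 < \<delta>" and small: "\<delta> < min (c_S * (1 - c_F) / (L_FIX * L_S * (c_S + L_R))) 1" for \<delta>
  proof -
    have \<delta>: "0 < \<delta>" "\<delta> < 1" "\<delta> < c_S * (1 - c_F) / (L_FIX * L_S * (c_S + L_R))"
      using that by auto
    obtain p \<rho> where p: "0 < p" and \<rho>: "0 < \<rho>" "\<rho> < 1"
      and weight: "p * (1 - \<delta> * c_S) + \<delta> * L_FIX * L_R \<le> \<rho> * p"
        "p * (\<delta> * L_S) + (c_F + \<delta> * L_FIX * L_S) \<le> \<rho>"
      using small_gain_weight[OF c_S(1) c_F(1) L_FIX(1) L_S(1) L_R(1) \<delta>(1,3)] by metis
    define C where "C = (p + 1) / min p 1"
    have C: "0 < C"
      using p by (simp add: C_def)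
    have decay: "norm (vector [?dS (x t) xstar, ?dF (z t) (Zfix (x t))] :: real ^ 2)
        \<le> C * \<rho> ^ t * norm (vector [?dS (x 0) xstar, ?dF (z 0) (Zfix (x 0))] :: real ^ 2)"
      and in_X: "x t \<in> X"
      if traj: "trajectory S F \<delta> x z" "x 0 \<in> X" "z 0 \<in> Z" for x z t
    proof -
      have recur: "x (Suc t) = x t + \<delta> *\<^sub>R S (x t) (z t)" "z (Suc t) = F (x t) (z t)" for t
        using traj(1) by (auto simp: trajectory_def)
      have "x t \<in> X \<and> z t \<in> Z" for t
      proof (induction t)
        case (Suc t)
        then show ?case
          using step_in[of "x t" "z t" \<delta>] \<delta> by (simp add: recur)
      qed (use traj in simp)
      then have inXZ: "x t \<in> X" "z t \<in> Z" for t
        by auto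
      show "x t \<in> X"
        by (rule inXZ)
      define a b where "a t = ?dS (x t) xstar" and "b t = ?dF (z t) (Zfix (x t))" for t
      have nonneg: "0 \<le> a t" "0 \<le> b t" for t
      proof -
        show "0 \<le> a t" "0 \<le> b t"
          by (simp_all add: a_def b_def ip_dist_def ip_norm_nonneg[OF ipS] ip_setdist_nonneg[OF ipF] Zfix_ne[OF inXZ(1)])
      qed
      have "a (Suc t) \<le> (1 - \<delta> * c_S) * a t + \<delta> * L_S * b t"
        "b (Suc t) \<le> \<delta> * L_FIX * L_R * a t + (c_F + \<delta> * L_FIX * L_S) * b t" for t
        unfolding a_def b_def recur by (rule slow[OF inXZ \<delta>(1,2)] fast[OF inXZ \<delta>(1,2)])+
      then have "p * a t + b t \<le> \<rho> ^ t * (p * a 0 + b 0)"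
        using nonneg p \<rho> weight by (intro weighted_sum_geometric_decay) auto
      then have "norm (vector [a t, b t] :: real ^ 2)
          \<le> (p + 1) / min p 1 * \<rho> ^ t * norm (vector [a 0, b 0] :: real ^ 2)"
        using nonneg p \<rho> by (intro norm_vector_2_decay) auto
      then show "norm (vector [?dS (x t) xstar, ?dF (z t) (Zfix (x t))] :: real ^ 2)
          \<le> C * \<rho> ^ t * norm (vector [?dS (x 0) xstar, ?dF (z 0) (Zfix (x 0))] :: real ^ 2)"
        by (simp add: a_def b_def C_def)
    qed
    have limits: "x \<longlonglongrightarrow> xstar \<and> vanishes_linearly (\<lambda>t. ?dS (x t) xstar) \<and>
        vanishes_linearly (\<lambda>t. ?dF (z t) (Zfix (x t)))"
      if traj: "trajectory S F \<delta> x z" "x 0 \<in> X" "z 0 \<in> Z" for x z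
    proof -
      define n where "n = norm (vector [?dS (x 0) xstar, ?dF (z 0) (Zfix (x 0))] :: real ^ 2)"
      have coord: "\<bar>u\<bar> \<le> norm (vector [u, v] :: real ^ 2)" "\<bar>v\<bar> \<le> norm (vector [u, v] :: real ^ 2)"
        for u v :: real
        by (auto simp: norm_vector_2 real_le_rsqrt)
      have bound: "norm (vector [?dS (x t) xstar, ?dF (z t) (Zfix (x t))] :: real ^ 2) \<le> C * n * \<rho> ^ t" for t
        using decay[OF traj, of t] by (simp add: n_def mult.assoc mult.commute mult.left_commute)
      have slow_lin: "vanishes_linearly (\<lambda>t. ?dS (x t) xstar)"
        by (rule vanishes_linearly_if_geometric_bound[OF \<rho> order_trans[OF coord(1) bound]])
      have fast_lin: "vanishes_linearly (\<lambda>t. ?dF (z t) (Zfix (x t)))"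
        by (rule vanishes_linearly_if_geometric_bound[OF \<rho> order_trans[OF coord(2) bound]])
      have "(\<lambda>t. x t - xstar) \<longlonglongrightarrow> 0"
      proof (rule Lim_null_comparison)
        show "\<forall>\<^sub>F t in sequentially. norm (x t - xstar) \<le> inverse k * ?dS (x t) xstar"
          using k by (simp add: ip_dist_def field_simps)
        show "(\<lambda>t. inverse k * ?dS (x t) xstar) \<longlonglongrightarrow> 0"
          using slow_lin by (intro tendsto_mult_right_zero) (simp add: vanishes_linearly_def)
      qed
      then show ?thesis
        using slow_lin fast_lin by (simp add: LIM_zero_iff)
    qed
    show ?thesis
      using C \<rho> decay limits by blast
  qed
  show ?thesis
    using xstar unique main by blast
qed

end
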